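(* Let $G=(V,E)$ be a connected, locally finite simple graph (possibly infinite) with minimum vertex degree $\delta(G)$ and edge-connectivity $\kappa'(G)$. If $G$ has non-negative Lin-Lu-Yau curvature, then $\kappa'(G)\ge\delta(G)-1$.
   Context: All graphs are simple (no loops or multiple edges) and locally finite. The edge-connectivity $\kappa'(G)$ of a graph with at least two vertices is the minimum cardinality of an edge cut, where an edge cut is a set of edges whose deletion increases the number of connected components; the edge-connectivity of a single vertex is $0$. Let $d(x,y)$ be the combinatorial graph distance and $d_x$ the degree of $x$. For probability measures $\mu_1,\mu_2$ on $V$, the Wasserstein distance is $W(\mu_1,\mu_2)=\inf_\pi\sum_{x,y\in V}d(x,y)\pi(x,y)$, the infimum over all $\pi:V\times V\to[0,1]$ with $\sum_y\pi(x,y)=\mu_1(x)$ and $\sum_x\pi(x,y)=\mu_2(y)$ for all $x,y$. For $x\in V$ and $\rho\in[0,1]$ let $\mu_x^\rho(x)=\rho$, $\mu_x^\rho(v)=\frac{1-\rho}{d_x}$ if $v\sim x$, and $\mu_x^\rho(v)=0$ otherwise. For distinct $x,y$, $\kappa_\rho(x,y)=1-\frac{W(\mu_x^\rho,\mu_y^\rho)}{d(x,y)}$, and the Lin-Lu-Yau curvature is $\kappa_{LLY}(x,y)=\lim_{\rho\to1}\frac{\kappa_\rho(x,y)}{1-\rho}$. $G$ has non-negative Lin-Lu-Yau curvature if $\kappa_{LLY}(x,y)\ge0$ for all pairs of distinct vertices $x,y$ (equivalently, for all edges $x\sim y$). *)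

theory Defs
  imports "HOL-Analysis.Infinite_Sum" "HOL-Library.Equipollence"
begin

text \<open>Graphs are given by a vertex set \<open>V\<close> and a set \<open>E\<close> of two-element subsets of \<open>V\<close>; both may
  be infinite.\<close>

definition simple_graph :: "'a set \<Rightarrow> 'a set set \<Rightarrow> bool" where
  "simple_graph V E \<longleftrightarrow> (\<forall>e\<in>E. e \<subseteq> V \<and> card e = 2)"

definition adj_rel :: "'a set set \<Rightarrow> 'a rel" where
  "adj_rel E = {(x, y). {x, y} \<in> E}"

definition neighbors :: "'a set set \<Rightarrow> 'a \<Rightarrow> 'a set" where
  "neighbors E x = {y. {x, y} \<in> E}"

definition degree :: "'a set set \<Rightarrow> 'a \<Rightarrow> nat" where
  "degree E x = card (neighbors E x)"

definition locally_finite :: "'a set \<Rightarrow> 'a set set \<Rightarrow> bool" where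
  "locally_finite V E \<longleftrightarrow> (\<forall>x\<in>V. finite (neighbors E x))"

definition min_degree :: "'a set \<Rightarrow> 'a set set \<Rightarrow> nat" where
  "min_degree V E = (INF x\<in>V. degree E x)"

definition graph_connected :: "'a set \<Rightarrow> 'a set set \<Rightarrow> bool" where
  "graph_connected V E \<longleftrightarrow> V \<noteq> {} \<and> (\<forall>x\<in>V. \<forall>y\<in>V. (x, y) \<in> (adj_rel E)\<^sup>*)"

definition graph_components :: "'a set \<Rightarrow> 'a set set \<Rightarrow> 'a set set" where
  "graph_components V E = V // {(x, y). x \<in> V \<and> y \<in> V \<and> (x, y) \<in> (adj_rel E)\<^sup>*}"

text \<open>The numbers of components before and after deletion are compared as cardinals, so that no
  finiteness of either is presupposed.\<close>

definition edge_cut :: "'a set \<Rightarrow> 'a set set \<Rightarrow> 'a set set \<Rightarrow> bool" where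
  "edge_cut V E F \<longleftrightarrow> F \<subseteq> E \<and> graph_components V E \<prec> graph_components V (E - F)"

text \<open>Finiteness of \<open>F\<close> is required because \<open>card\<close> is \<open>0\<close> on infinite sets. In a connected, locally
  finite graph with at least two vertices a finite edge cut always exists, namely the set of all
  edges at one vertex.\<close>

definition edge_connectivity :: "'a set \<Rightarrow> 'a set set \<Rightarrow> nat" where
  "edge_connectivity V E =
     (if card V = 1 then 0 else (LEAST k. \<exists>F. edge_cut V E F \<and> finite F \<and> card F = k))"

definition graph_dist :: "'a set set \<Rightarrow> 'a \<Rightarrow> 'a \<Rightarrow> nat" where
  "graph_dist E x y = (LEAST n. (x, y) \<in> adj_rel E ^^ n)"

definition transport_plan :: "'a set \<Rightarrow> ('a \<Rightarrow> real) \<Rightarrow> ('a \<Rightarrow> real) \<Rightarrow> ('a \<times> 'a \<Rightarrow> real) \<Rightarrow> bool" where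
  "transport_plan V \<mu>1 \<mu>2 \<pi> \<longleftrightarrow>
     (\<forall>x\<in>V. \<forall>y\<in>V. 0 \<le> \<pi> (x, y) \<and> \<pi> (x, y) \<le> 1) \<and>
     (\<forall>x\<in>V. ((\<lambda>y. \<pi> (x, y)) has_sum \<mu>1 x) V) \<and>
     (\<forall>y\<in>V. ((\<lambda>x. \<pi> (x, y)) has_sum \<mu>2 y) V)"

text \<open>Plans of infinite cost are left out of the infimum by \<open>has_sum\<close>; they cannot lower it (whereas
  \<open>infsum\<close> would assign them the value \<open>0\<close>). Between finitely supported measures on a connected
  graph every plan has finite cost.\<close>

definition wasserstein :: "'a set \<Rightarrow> 'a set set \<Rightarrow> ('a \<Rightarrow> real) \<Rightarrow> ('a \<Rightarrow> real) \<Rightarrow> real" where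
  "wasserstein V E \<mu>1 \<mu>2 =
     Inf {c. \<exists>\<pi>. transport_plan V \<mu>1 \<mu>2 \<pi> \<and>
                 ((\<lambda>(x, y). real (graph_dist E x y) * \<pi> (x, y)) has_sum c) (V \<times> V)}"

definition lazy_walk :: "'a set set \<Rightarrow> real \<Rightarrow> 'a \<Rightarrow> 'a \<Rightarrow> real" where
  "lazy_walk E \<rho> x v =
     (if v = x then \<rho> else if v \<in> neighbors E x then (1 - \<rho>) / real (degree E x) else 0)"

definition lazy_curvature :: "'a set \<Rightarrow> 'a set set \<Rightarrow> real \<Rightarrow> 'a \<Rightarrow> 'a \<Rightarrow> real" where
  "lazy_curvature V E \<rho> x y =
     1 - wasserstein V E (lazy_walk E \<rho> x) (lazy_walk E \<rho> y) / real (graph_dist E x y)"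

text \<open>The limit is one-sided since the idleness \<open>\<rho>\<close> ranges over \<open>[0, 1]\<close>.\<close>

definition lly_curvature :: "'a set \<Rightarrow> 'a set set \<Rightarrow> 'a \<Rightarrow> 'a \<Rightarrow> real" where
  "lly_curvature V E x y = Lim (at_left 1) (\<lambda>\<rho>. lazy_curvature V E \<rho> x y / (1 - \<rho>))"

definition nonneg_lly_curvature :: "'a set \<Rightarrow> 'a set set \<Rightarrow> bool" where
  "nonneg_lly_curvature V E \<longleftrightarrow> (\<forall>x\<in>V. \<forall>y\<in>V. x \<noteq> y \<longrightarrow> lly_curvature V E x y \<ge> 0)"

end

theory Submission
  imports Defs
begin

text \<open>Let \<open>S\<close> be one side of a minimum cut with \<open>k\<close> edges, and let \<open>f\<close> be the \<open>1\<close>-Lipschitz function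
  with values \<open>-1, 0\<close> on \<open>S\<close> and \<open>1, 2\<close> off \<open>S\<close> that equals \<open>0\<close> and \<open>1\<close> exactly at the endpoints of
  the cut edges. The easy half of Kantorovich duality turns non-negative curvature into
  \<open>\<Delta> f b \<le> \<Delta> f a\<close> for every cut edge from \<open>a\<close> in \<open>S\<close> to \<open>b\<close> off \<open>S\<close>. If every degree is at least
  \<open>k + 2\<close>, this reads \<open>2 k + 6 \<le> 2 c(a) + 2 c(b) + p + q\<close>, where \<open>c\<close> counts the cut edges at a
  vertex and \<open>p\<close>, \<open>q\<close> the endpoints of cut edges in \<open>S\<close> and off \<open>S\<close>. Counting the \<open>k\<close> cut edges
  then forces \<open>p = 1\<close> or \<open>q = 1\<close>, that is, all cut edges meet in one vertex; moving this
  vertex across the cut contradicts minimality.\<close>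

section \<open>Transport plans\<close>

text \<open>Non-negative entries with sum 0 all vanish. This confines a plan to the product of the
  supports of its marginals, so that later sums are finite.\<close>

lemma transport_plan_eq_0:
  assumes "transport_plan V \<mu>1 \<mu>2 \<pi>" "u \<in> V" "v \<in> V" "\<mu>1 u = 0 \<or> \<mu>2 v = 0"
  shows "\<pi> (u, v) = 0"
  using assms(4)
proof
  assume "\<mu>1 u = 0"
  then have "((\<lambda>y. \<pi> (u, y)) has_sum 0) V"
    using assms(1,2) unfolding transport_plan_def by metis
  moreover have "\<pi> (u, y) \<ge> 0" if "y \<in> V" for y
    using assms(1,2) that unfolding transport_plan_def by blast
  ultimately show ?thesis
    using nonneg_has_sum_le_0D[of "\<lambda>y. \<pi> (u, y)" V 0 v] assms(3) by simp
next
  assume "\<mu>2 v = 0"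
  then have "((\<lambda>x. \<pi> (x, v)) has_sum 0) V"
    using assms(1,3) unfolding transport_plan_def by metis
  moreover have "\<pi> (x, v) \<ge> 0" if "x \<in> V" for x
    using assms(1,3) that unfolding transport_plan_def by blast
  ultimately show ?thesis
    using nonneg_has_sum_le_0D[of "\<lambda>x. \<pi> (x, v)" V 0 u] assms(2) by simp
qed

text \<open>Weak Kantorovich duality: sum \<open>lip\<close> against the weights
  \<open>\<pi>\<close> and evaluate the left side by the marginals.\<close>

lemma transport_cost_ge:
  fixes f :: "'a \<Rightarrow> real"
  assumes plan: "transport_plan V \<mu>1 \<mu>2 \<pi>"
    and S: "finite S" "S \<subseteq> V" "\<And>u. u \<in> V - S \<Longrightarrow> \<mu>1 u = 0"
    and T: "finite T" "T \<subseteq> V" "\<And>v. v \<in> V - T \<Longrightarrow> \<mu>2 v = 0"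
    and lip: "\<And>u v. u \<in> V \<Longrightarrow> v \<in> V \<Longrightarrow> f v - f u \<le> D u v"
    and cost: "((\<lambda>(u, v). D u v * \<pi> (u, v)) has_sum c) (V \<times> V)"
  shows "(\<Sum>v\<in>T. f v * \<mu>2 v) - (\<Sum>u\<in>S. f u * \<mu>1 u) \<le> c"
proof -
  have zero: "\<pi> (u, v) = 0" if "u \<in> V" "v \<in> V" "u \<notin> S \<or> v \<notin> T" for u v
    using transport_plan_eq_0[OF plan that(1,2)] that S(3) T(3) by blast
  have row: "\<mu>1 u = (\<Sum>v\<in>T. \<pi> (u, v))" if "u \<in> S" for u
  proof (rule has_sum_unique)
    show "((\<lambda>v. \<pi> (u, v)) has_sum \<mu>1 u) V"
      using plan that S(2) unfolding transport_plan_def by blast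
    show "((\<lambda>v. \<pi> (u, v)) has_sum (\<Sum>v\<in>T. \<pi> (u, v))) V"
      using zero that S(2) T by (intro has_sum_finite_neutralI[of T]) auto
  qed
  have col: "\<mu>2 v = (\<Sum>u\<in>S. \<pi> (u, v))" if "v \<in> T" for v
  proof (rule has_sum_unique)
    show "((\<lambda>u. \<pi> (u, v)) has_sum \<mu>2 v) V"
      using plan that T(2) unfolding transport_plan_def by blast
    show "((\<lambda>u. \<pi> (u, v)) has_sum (\<Sum>u\<in>S. \<pi> (u, v))) V"
      using zero that S T(2) by (intro has_sum_finite_neutralI[of S]) auto
  qed
  have c: "c = (\<Sum>(u, v)\<in>S \<times> T. D u v * \<pi> (u, v))"
    using S T by (intro has_sum_unique[OF cost] has_sum_finite_neutralI[of "S \<times> T"]) (auto intro: zero)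
  have "(\<Sum>v\<in>T. f v * \<mu>2 v) = (\<Sum>v\<in>T. \<Sum>u\<in>S. f v * \<pi> (u, v))"
    by (simp add: col sum_distrib_left)
  also have "\<dots> = (\<Sum>u\<in>S. \<Sum>v\<in>T. f v * \<pi> (u, v))"
    by (rule sum.swap)
  finally have "(\<Sum>v\<in>T. f v * \<mu>2 v) - (\<Sum>u\<in>S. f u * \<mu>1 u)
      = (\<Sum>u\<in>S. \<Sum>v\<in>T. (f v - f u) * \<pi> (u, v))"
    by (simp add: row sum_distrib_left sum_subtractf left_diff_distrib)
  also have "\<dots> \<le> (\<Sum>u\<in>S. \<Sum>v\<in>T. D u v * \<pi> (u, v))"
    using plan S(2) T(2) lip unfolding transport_plan_def
    by (intro sum_mono mult_right_mono) blast+
  also have "\<dots> = c"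
    using c by (simp add: sum.cartesian_product)
  finally show ?thesis .
qed

text \<open>The independent coupling, a witness that the infimum in \<open>wasserstein\<close> is
  over a non-empty set.\<close>

lemma transport_plan_product:
  assumes S: "finite S" "S \<subseteq> V" "\<And>u. u \<in> V - S \<Longrightarrow> \<mu>1 u = 0"
    and T: "finite T" "T \<subseteq> V" "\<And>v. v \<in> V - T \<Longrightarrow> \<mu>2 v = 0"
    and \<mu>1: "\<And>u. 0 \<le> \<mu>1 u" "(\<Sum>u\<in>S. \<mu>1 u) = 1"
    and \<mu>2: "\<And>v. 0 \<le> \<mu>2 v" "(\<Sum>v\<in>T. \<mu>2 v) = 1"
  shows "transport_plan V \<mu>1 \<mu>2 (\<lambda>(u, v). \<mu>1 u * \<mu>2 v)"
proof -
  have "\<mu>1 u \<le> 1" if "u \<in> V" for u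
    using member_le_sum[of u S \<mu>1] S \<mu>1 that by (cases "u \<in> S") auto
  moreover have "\<mu>2 v \<le> 1" if "v \<in> V" for v
    using member_le_sum[of v T \<mu>2] T \<mu>2 that by (cases "v \<in> T") auto
  ultimately have "\<forall>u\<in>V. \<forall>v\<in>V. 0 \<le> \<mu>1 u * \<mu>2 v \<and> \<mu>1 u * \<mu>2 v \<le> 1"
    using \<mu>1(1) \<mu>2(1) by (auto intro: mult_le_one)
  moreover have "(\<mu>2 has_sum 1) V" "(\<mu>1 has_sum 1) V"
    using has_sum_finite_neutralI[OF S(1,2)] has_sum_finite_neutralI[OF T(1,2)] S(3) T(3) \<mu>1(2) \<mu>2(2)
    by metis+
  ultimately show ?thesis
    unfolding transport_plan_def
    using has_sum_cmult_right[of \<mu>2 V 1] has_sum_cmult_left[of \<mu>1 V 1] by auto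
qed

lemma transport_plan_convex:
  assumes "transport_plan V \<mu>1 \<mu>2 \<pi>" "transport_plan V \<nu>1 \<nu>2 \<sigma>" "0 \<le> t" "t \<le> 1"
  shows "transport_plan V (\<lambda>v. (1 - t) * \<mu>1 v + t * \<nu>1 v) (\<lambda>v. (1 - t) * \<mu>2 v + t * \<nu>2 v)
           (\<lambda>p. (1 - t) * \<pi> p + t * \<sigma> p)"
  using assms unfolding transport_plan_def
  by (auto intro!: has_sum_add has_sum_cmult_right convex_bound_le)

lemma transport_plan_point:
  assumes "x \<in> V" "y \<in> V"
  shows "transport_plan V (\<lambda>v. of_bool (v = x)) (\<lambda>v. of_bool (v = y)) (\<lambda>p. of_bool (p = (x, y)))"
proof -
  have "((\<lambda>v. of_bool ((u, v) = (x, y)) :: real) has_sum of_bool (u = x)) V" for u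
    using assms by (intro has_sum_finite_neutralI[of "{y}"]) auto
  moreover have "((\<lambda>u. of_bool ((u, v) = (x, y)) :: real) has_sum of_bool (v = y)) V" for v
    using assms by (intro has_sum_finite_neutralI[of "{x}"]) auto
  ultimately show ?thesis
    unfolding transport_plan_def by auto
qed

section \<open>Counting pairs in a finite relation\<close>

text \<open>Each element of \<open>Domain R - X\<close> starts at least one pair, in addition to the
  pairs that start in \<open>X\<close>.\<close>

lemma sum_card_Image_le:
  assumes R: "finite R" and X: "X \<subseteq> Domain R"
  shows "(\<Sum>a\<in>X. card (R `` {a})) + card (Domain R) \<le> card R + card X"
proof -
  have fin: "finite (Domain R)" "finite X"
    using R X finite_Domain finite_subset by blast+
  have img: "finite (R `` {a})" for a
    using R by (rule finite_Image)
  have "R = Sigma (Domain R) (\<lambda>a. R `` {a})"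
    by auto
  then have "card R = (\<Sum>a\<in>Domain R. card (R `` {a}))"
    using card_SigmaI[of "Domain R" "\<lambda>a. R `` {a}"] fin img by metis
  also have "\<dots> = (\<Sum>a\<in>Domain R - X. card (R `` {a})) + (\<Sum>a\<in>X. card (R `` {a}))"
    by (rule sum.subset_diff[OF X fin(1)])
  finally have "card R = \<dots>" .
  moreover have "(\<Sum>a\<in>Domain R - X. 1) \<le> (\<Sum>a\<in>Domain R - X. card (R `` {a}))"
    using img by (intro sum_mono) (auto simp: Suc_le_eq card_gt_0_iff)
  moreover have "card (Domain R - X) + card X = card (Domain R)"
    using X fin by (metis card_Diff_subset card_mono le_add_diff_inverse2)
  ultimately show ?thesis by simp
qed

lemma card_Image_le:
  "finite R \<Longrightarrow> a \<in> Domain R \<Longrightarrow> card (R `` {a}) + card (Domain R) \<le> card R + 1"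
  using sum_card_Image_le[of R "{a}"] by simp

lemma card_Image_two_le:
  "finite R \<Longrightarrow> a \<in> Domain R \<Longrightarrow> a' \<in> Domain R \<Longrightarrow> a \<noteq> a' \<Longrightarrow>
     card (R `` {a}) + card (R `` {a'}) + card (Domain R) \<le> card R + 2"
  using sum_card_Image_le[of R "{a, a'}"] by simp

text \<open>In terms of the set \<open>H\<close> of the proof and its analogue on the other side: every pair in \<open>R\<close> has an
  end in one of them, and both have at most one element.\<close>

lemma light_element:
  assumes R: "finite R" and two: "card (Domain R) \<ge> 2" "card (Range R) \<ge> 2"
    and heavy: "\<And>a b. (a, b) \<in> R \<Longrightarrow> 2 * card R + 6 \<le>
      2 * card (R `` {a}) + 2 * card (R\<inverse> `` {b}) + card (Domain R) + card (Range R)"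
  obtains a b where "(a, b) \<in> R" "card (R `` {a}) = 1"
proof -
  \<comment> \<open>The threshold is half of \<open>2 * card R + 6\<close>: in a pair whose first
    element is outside \<open>H\<close>, the second must supply the other half.\<close>
  define H where "H = {a \<in> Domain R. 2 * card (R `` {a}) + card (Domain R) \<ge> card R + 3}"
  \<comment> \<open>Two distinct members would make a sum at least \<open>card R + 3\<close> that
    \<open>card_Image_two_le\<close> bounds by \<open>card R + 2\<close>.\<close>
  have H: "a = a'" if "a \<in> H" "a' \<in> H" for a a'
    using card_Image_two_le[OF R, of a a'] that unfolding H_def by force
  have "\<not> Domain R \<subseteq> H"
  proof
    assume "Domain R \<subseteq> H"
    then have "card (Domain R) \<le> Suc 0"
      using H finite_Domain[OF R] by (subst card_le_Suc0_iff_eq) blast+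
    with two show False by simp
  qed
  then obtain a where a: "a \<in> Domain R" "a \<notin> H"
    by blast
  \<comment> \<open>All partners of \<open>a\<close> are above the threshold on their side, where
    again only one element can be.\<close>
  have b: "2 * card (R\<inverse> `` {b}) + card (Range R) \<ge> card R + 3" if "b \<in> R `` {a}" for b
    using heavy[of a b] that a unfolding H_def by simp
  have "b = b'" if "b \<in> R `` {a}" "b' \<in> R `` {a}" for b b'
    using card_Image_two_le[of "R\<inverse>" b b'] R b[OF that(1)] b[OF that(2)] that
    by (force simp: Domain_converse card_inverse)
  then have "card (R `` {a}) \<le> Suc 0"
    using finite_Image[OF R, of "{a}"] by (subst card_le_Suc0_iff_eq) auto
  moreover have "card (R `` {a}) > 0"
    using finite_Image[OF R, of "{a}"] a by (auto simp: card_gt_0_iff)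
  ultimately show ?thesis
    using a that by (metis DomainE One_nat_def Suc_leI le_antisym)
qed

text \<open>Otherwise there are pairs \<open>(a, b)\<close> and \<open>(a', b')\<close> such that
  \<open>a\<close> and \<open>b'\<close> each occur in one pair only. After
  \<open>card_Image_le\<close> bounds the terms of \<open>b\<close> and \<open>a'\<close>, the two
  inequalities \<open>heavy\<close> add up to
  \<open>4 * card R + 12 \<le> 4 * card R + 8\<close>.\<close>

lemma star_if_heavy:
  assumes R: "finite R"
    and heavy: "\<And>a b. (a, b) \<in> R \<Longrightarrow> 2 * card R + 6 \<le>
      2 * card (R `` {a}) + 2 * card (R\<inverse> `` {b}) + card (Domain R) + card (Range R)"
  shows "card (Domain R) \<le> 1 \<or> card (Range R) \<le> 1"
proof (rule ccontr)
  assume "\<not> ?thesis"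
  then have two: "card (Domain R) \<ge> 2" "card (Range R) \<ge> 2"
    by auto
  obtain a b where ab: "(a, b) \<in> R" "card (R `` {a}) = 1"
    using light_element[OF R two heavy] by blast
  have heavy': "2 * card (R\<inverse>) + 6 \<le> 2 * card (R\<inverse> `` {b}) + 2 * card ((R\<inverse>)\<inverse> `` {a})
      + card (Domain (R\<inverse>)) + card (Range (R\<inverse>))" if "(b, a) \<in> R\<inverse>" for a b
    using heavy[of a b] that by (simp add: card_inverse)
  obtain b' a' where ab': "(a', b') \<in> R" "card (R\<inverse> `` {b'}) = 1"
    by (rule light_element[OF _ _ _ heavy']) (use R two in auto)
  have "card (R\<inverse> `` {b}) + card (Range R) \<le> card R + 1"
    using card_Image_le[of "R\<inverse>" b] R ab(1) by (auto simp: card_inverse)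
  moreover have "card (R `` {a'}) + card (Domain R) \<le> card R + 1"
    using card_Image_le[OF R, of a'] ab'(1) by auto
  ultimately show False
    using heavy[OF ab(1)] heavy[OF ab'(1)] ab(2) ab'(2) by linarith
qed

section \<open>Laplacian form of non-negative curvature\<close>

lemma sum_of_bool_mem: "finite A \<Longrightarrow> X \<subseteq> A \<Longrightarrow> (\<Sum>z\<in>A. of_bool (z \<in> X)) = real (card X)"
  by (simp add: sum_of_bool_eq Int_absorb1)

definition laplacian :: "'a set set \<Rightarrow> ('a \<Rightarrow> real) \<Rightarrow> 'a \<Rightarrow> real" where
  "laplacian E f x = (\<Sum>z\<in>neighbors E x. f z - f x) / real (degree E x)"

section \<open>Neighbours, distances and Lipschitz functions\<close>

locale connected_lf_graph =
  fixes V :: "'a set" and E :: "'a set set"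
  assumes simple: "simple_graph V E"
    and lf: "locally_finite V E"
    and conn: "graph_connected V E"
begin

lemma neighbors_sym: "y \<in> neighbors E x \<longleftrightarrow> x \<in> neighbors E y"
  by (simp add: neighbors_def insert_commute)

lemma neighborsD:
  assumes "y \<in> neighbors E x"
  shows "x \<in> V" "y \<in> V" "x \<noteq> y"
proof -
  have "{x, y} \<subseteq> V \<and> card {x, y} = 2"
    using assms simple unfolding neighbors_def simple_graph_def by blast
  then show "x \<in> V" "y \<in> V" "x \<noteq> y" by auto
qed

lemma finite_neighbors: "x \<in> V \<Longrightarrow> finite (neighbors E x)"
  using lf unfolding locally_finite_def by blast

lemma degree_pos: "y \<in> neighbors E x \<Longrightarrow> degree E x > 0"
  using finite_neighbors neighborsD(1) unfolding degree_def by (fastforce simp: card_gt_0_iff)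

lemma graph_dist_edge:
  assumes "y \<in> neighbors E x"
  shows "graph_dist E x y = 1"
  unfolding graph_dist_def
proof (rule Least_equality)
  show "(x, y) \<in> adj_rel E ^^ 1"
    using assms by (simp add: adj_rel_def neighbors_def)
  show "1 \<le> n" if "(x, y) \<in> adj_rel E ^^ n" for n
    using that neighborsD(3)[OF assms] by (cases n) auto
qed

lemma lipschitz_graph_dist:
  fixes f :: "'a \<Rightarrow> real"
  assumes lip: "\<And>u v. v \<in> neighbors E u \<Longrightarrow> f v - f u \<le> 1"
    and "u \<in> V" "v \<in> V"
  shows "f v - f u \<le> real (graph_dist E u v)"
proof -
  have walk: "f w - f u \<le> real n" if "(u, w) \<in> adj_rel E ^^ n" for n w
    using that
  proof (induction n arbitrary: w)
    case 0
    then show ?case by simp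
  next
    case (Suc n)
    then obtain z where "(u, z) \<in> adj_rel E ^^ n" "(z, w) \<in> adj_rel E"
      by auto
    with Suc.IH[of z] lip[of w z] show ?case
      by (auto simp: adj_rel_def neighbors_def)
  qed
  \<comment> \<open>Connectivity provides a walk, so the \<open>LEAST\<close> in
    \<open>graph_dist\<close> is attained.\<close>
  have "(u, v) \<in> (adj_rel E)\<^sup>*"
    using conn assms(2,3) unfolding graph_connected_def by blast
  then have "\<exists>n. (u, v) \<in> adj_rel E ^^ n"
    by (simp add: rtrancl_power)
  then have "(u, v) \<in> adj_rel E ^^ graph_dist E u v"
    unfolding graph_dist_def by (rule LeastI_ex)
  then show ?thesis by (rule walk)
qed

section \<open>Lazy random walks and their transport costs\<close>

lemma lazy_walk_nonneg: "0 \<le> \<rho> \<Longrightarrow> \<rho> \<le> 1 \<Longrightarrow> 0 \<le> lazy_walk E \<rho> x v"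
  by (simp add: lazy_walk_def)

text \<open>The mean of \<open>f\<close> under the walk is affine in \<open>1 - \<rho>\<close> with
  the Laplacian as slope. The neighbour \<open>y\<close> guarantees a positive degree, hence total
  mass 1.\<close>

lemma sum_lazy_walk:
  assumes "y \<in> neighbors E x"
  shows "(\<Sum>v\<in>insert x (neighbors E x). f v * lazy_walk E \<rho> x v) = f x + (1 - \<rho>) * laplacian E f x"
proof -
  have x: "x \<notin> neighbors E x" "finite (neighbors E x)" "degree E x \<noteq> 0"
    using neighborsD[OF assms] finite_neighbors degree_pos[OF assms] neighborsD(3) by auto
  have "(\<Sum>v\<in>neighbors E x. f v * lazy_walk E \<rho> x v)
      = (\<Sum>v\<in>neighbors E x. f v * ((1 - \<rho>) / real (degree E x)))"
    using x by (intro sum.cong) (auto simp: lazy_walk_def)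
  also have "\<dots> = (1 - \<rho>) * ((\<Sum>v\<in>neighbors E x. f v) / real (degree E x))"
    by (simp add: sum_distrib_left sum_divide_distrib mult.commute)
  also have "(\<Sum>v\<in>neighbors E x. f v) / real (degree E x) = laplacian E f x + f x"
    using x by (simp add: laplacian_def sum_subtractf field_simps flip: degree_def)
  finally show ?thesis
    using x by (simp add: lazy_walk_def algebra_simps)
qed

lemma lazy_walk_outside: "v \<in> V - insert x (neighbors E x) \<Longrightarrow> lazy_walk E \<rho> x v = 0"
  by (simp add: lazy_walk_def)

text \<open>Exactly the set under the infimum in \<open>wasserstein\<close>, so that unfolding
  leaves goals about it.\<close>

abbreviation transport_costs :: "('a \<Rightarrow> real) \<Rightarrow> ('a \<Rightarrow> real) \<Rightarrow> real set" where
  "transport_costs \<mu>1 \<mu>2 \<equiv> {c. \<exists>\<pi>. transport_plan V \<mu>1 \<mu>2 \<pi> \<and>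
     ((\<lambda>(x, y). real (graph_dist E x y) * \<pi> (x, y)) has_sum c) (V \<times> V)}"

lemma transport_costs_nonneg: "c \<in> transport_costs \<mu>1 \<mu>2 \<Longrightarrow> 0 \<le> c"
proof -
  assume "c \<in> transport_costs \<mu>1 \<mu>2"
  then obtain \<pi> where "transport_plan V \<mu>1 \<mu>2 \<pi>"
    and "((\<lambda>(x, y). real (graph_dist E x y) * \<pi> (x, y)) has_sum c) (V \<times> V)"
    by blast
  then show "0 \<le> c"
    unfolding transport_plan_def by (elim has_sum_nonneg) auto
qed

lemma bdd_below_transport_costs: "bdd_below (transport_costs \<mu>1 \<mu>2)"
  using transport_costs_nonneg by (intro bdd_belowI[where m = 0]) blast

context
  fixes x y
  assumes xy: "y \<in> neighbors E x"
begin

lemma yx: "x \<in> neighbors E y"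
  using xy neighbors_sym by blast

lemma balls:
  "finite (insert x (neighbors E x))" "insert x (neighbors E x) \<subseteq> V"
  "finite (insert y (neighbors E y))" "insert y (neighbors E y) \<subseteq> V"
  using neighborsD[OF xy] finite_neighbors neighborsD(2) by auto

lemma transport_costs_lazy_walk_nonempty:
  assumes "0 \<le> \<rho>" "\<rho> \<le> 1"
  shows "transport_costs (lazy_walk E \<rho> x) (lazy_walk E \<rho> y) \<noteq> {}"
proof -
  let ?\<pi> = "\<lambda>(u, v). lazy_walk E \<rho> x u * lazy_walk E \<rho> y v"
  \<comment> \<open>Constant functions have Laplacian 0, so the mean of 1 is 1.\<close>
  have one: "(\<Sum>v\<in>insert z (neighbors E z). lazy_walk E \<rho> z v) = 1" if "w \<in> neighbors E z" for w z
    using sum_lazy_walk[OF that, of "\<lambda>_. 1" \<rho>] by (simp add: laplacian_def)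
  have "transport_plan V (lazy_walk E \<rho> x) (lazy_walk E \<rho> y) ?\<pi>"
    using assms
    by (intro transport_plan_product[OF balls(1,2) _ balls(3,4)] lazy_walk_outside lazy_walk_nonneg
        one[OF xy] one[OF yx])
  moreover have "((\<lambda>(u, v). real (graph_dist E u v) * ?\<pi> (u, v)) has_sum
      (\<Sum>(u, v)\<in>insert x (neighbors E x) \<times> insert y (neighbors E y).
        real (graph_dist E u v) * ?\<pi> (u, v))) (V \<times> V)"
    using balls by (intro has_sum_finite_neutralI) (auto simp: lazy_walk_def split: if_splits)
  ultimately show ?thesis by blast
qed

text \<open>Weak duality with test function \<open>f\<close> bounds every plan's cost from below;
  \<open>sum_lazy_walk\<close> evaluates both means.\<close>

lemma wasserstein_lazy_walk_ge:
  fixes f :: "'a \<Rightarrow> real"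
  assumes "0 \<le> \<rho>" "\<rho> \<le> 1"
    and lip: "\<And>u v. v \<in> neighbors E u \<Longrightarrow> f v - f u \<le> 1"
  shows "f y - f x + (1 - \<rho>) * (laplacian E f y - laplacian E f x)
           \<le> wasserstein V E (lazy_walk E \<rho> x) (lazy_walk E \<rho> y)"
  unfolding wasserstein_def
proof (rule cInf_greatest)
  show "transport_costs (lazy_walk E \<rho> x) (lazy_walk E \<rho> y) \<noteq> {}"
    by (rule transport_costs_lazy_walk_nonempty) fact+
next
  fix c assume "c \<in> transport_costs (lazy_walk E \<rho> x) (lazy_walk E \<rho> y)"
  then obtain \<pi> where plan: "transport_plan V (lazy_walk E \<rho> x) (lazy_walk E \<rho> y) \<pi>"
    and cost: "((\<lambda>(x, y). real (graph_dist E x y) * \<pi> (x, y)) has_sum c) (V \<times> V)"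
    by blast
  have "(\<Sum>v\<in>insert y (neighbors E y). f v * lazy_walk E \<rho> y v)
      - (\<Sum>u\<in>insert x (neighbors E x). f u * lazy_walk E \<rho> x u) \<le> c"
    by (rule transport_cost_ge[OF plan balls(1,2) _ balls(3,4) _ _ cost])
      (auto intro: lazy_walk_outside lipschitz_graph_dist lip)
  then show "f y - f x + (1 - \<rho>) * (laplacian E f y - laplacian E f x) \<le> c"
    by (simp add: sum_lazy_walk[OF xy] sum_lazy_walk[OF yx] algebra_simps)
qed

text \<open>More idleness is obtained by mixing with the point masses at \<open>x\<close> and \<open>y\<close>, whose distance is \<open>1\<close>.\<close>

lemma wasserstein_lazy_walk_mix:
  assumes "0 \<le> \<rho>" "\<rho> \<le> 1" "0 \<le> t" "t \<le> 1"
  shows "wasserstein V E (lazy_walk E ((1 - t) * \<rho> + t) x) (lazy_walk E ((1 - t) * \<rho> + t) y)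
           \<le> (1 - t) * wasserstein V E (lazy_walk E \<rho> x) (lazy_walk E \<rho> y) + t"
    (is "?W' \<le> (1 - t) * ?W + t")
proof -
  let ?\<rho>' = "(1 - t) * \<rho> + t"
  have walk: "lazy_walk E ?\<rho>' z = (\<lambda>v. (1 - t) * lazy_walk E \<rho> z v + t * of_bool (v = z))" for z
  proof
    fix v
    have "1 - ?\<rho>' = (1 - t) * (1 - \<rho>)"
      by (simp add: algebra_simps)
    then show "lazy_walk E ?\<rho>' z v = (1 - t) * lazy_walk E \<rho> z v + t * of_bool (v = z)"
      by (simp add: lazy_walk_def)
  qed
  have le: "?W' \<le> (1 - t) * c + t"
    if c: "c \<in> transport_costs (lazy_walk E \<rho> x) (lazy_walk E \<rho> y)" for c
  proof -
    obtain \<pi> where plan: "transport_plan V (lazy_walk E \<rho> x) (lazy_walk E \<rho> y) \<pi>"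
      and cost: "((\<lambda>(x, y). real (graph_dist E x y) * \<pi> (x, y)) has_sum c) (V \<times> V)"
      using c by blast
    let ?\<delta> = "\<lambda>p. of_bool (p = (x, y)) :: real"
    have "transport_plan V (lazy_walk E ?\<rho>' x) (lazy_walk E ?\<rho>' y) (\<lambda>p. (1 - t) * \<pi> p + t * ?\<delta> p)"
      unfolding walk using assms neighborsD[OF xy]
      by (intro transport_plan_convex plan transport_plan_point)
    moreover have "((\<lambda>(u, v). real (graph_dist E u v) * ?\<delta> (u, v)) has_sum 1) (V \<times> V)"
      using neighborsD[OF xy] graph_dist_edge[OF xy]
      by (intro has_sum_finite_neutralI[of "{(x, y)}"]) auto
    from has_sum_add[OF has_sum_cmult_right[OF cost, of "1 - t"] has_sum_cmult_right[OF this, of t]]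
    have "((\<lambda>(u, v). real (graph_dist E u v) * ((1 - t) * \<pi> (u, v) + t * ?\<delta> (u, v)))
        has_sum ((1 - t) * c + t)) (V \<times> V)"
      by (simp add: case_prod_unfold algebra_simps)
    ultimately have "(1 - t) * c + t \<in> transport_costs (lazy_walk E ?\<rho>' x) (lazy_walk E ?\<rho>' y)"
      by blast
    then show ?thesis
      unfolding wasserstein_def by (rule cInf_lower[OF _ bdd_below_transport_costs])
  qed
  show ?thesis
  \<comment> \<open>Passing to the infimum over \<open>c\<close> divides by \<open>1 - t\<close>.
    For \<open>t = 1\<close> the cost has factor 0 and any single plan suffices.\<close>
  proof (cases "t = 1")
    case True
    then show ?thesis
      using transport_costs_lazy_walk_nonempty[OF assms(1,2)] le by force
  next
    case False
    with assms have t: "1 - t > 0" by simp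
    have "(?W' - t) / (1 - t) \<le> ?W"
      unfolding wasserstein_def[of V E "lazy_walk E \<rho> x"]
    proof (rule cInf_greatest[OF transport_costs_lazy_walk_nonempty[OF assms(1,2)]])
      show "(?W' - t) / (1 - t) \<le> c"
        if "c \<in> transport_costs (lazy_walk E \<rho> x) (lazy_walk E \<rho> y)" for c
        using le[OF that] t by (simp add: field_simps)
    qed
    then show ?thesis
      using t by (simp add: field_simps)
  qed
qed

text \<open>The quotient whose limit defines the curvature is nondecreasing and bounded by the difference of
  the Laplacians, so the limit exists and obeys the same bound.\<close>

lemma lly_curvature_le:
  fixes f :: "'a \<Rightarrow> real"
  assumes lip: "\<And>u v. v \<in> neighbors E u \<Longrightarrow> f v - f u \<le> 1"
    and fxy: "f y - f x = 1"
  shows "lly_curvature V E x y \<le> laplacian E f x - laplacian E f y"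
proof -
  define h where "h \<rho> = lazy_curvature V E \<rho> x y / (1 - \<rho>)" for \<rho>
  let ?W = "\<lambda>\<rho>. wasserstein V E (lazy_walk E \<rho> x) (lazy_walk E \<rho> y)"
  let ?B = "laplacian E f x - laplacian E f y"
  have h: "h \<rho> = (1 - ?W \<rho>) / (1 - \<rho>)" for \<rho>
    by (simp add: h_def lazy_curvature_def graph_dist_edge[OF xy])
  have bound: "h \<rho> \<le> ?B" if "\<rho> \<in> {0<..}" "\<rho> < 1" for \<rho>
  proof -
    have "1 - ?W \<rho> \<le> ?B * (1 - \<rho>)"
      using wasserstein_lazy_walk_ge[of \<rho> f] lip fxy that by (simp add: algebra_simps)
    then show ?thesis
      unfolding h using that by (simp add: pos_divide_le_eq)
  qed
  have mono: "h \<rho> \<le> h \<sigma>" if "\<rho> \<in> {0<..}" "\<sigma> \<in> {0<..}" "\<sigma> < 1" "\<rho> \<le> \<sigma>" for \<rho> \<sigma>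
  proof -
    \<comment> \<open>Chosen so that mixing idleness \<open>\<rho>\<close> with weight
      \<open>t\<close> on the point masses yields idleness \<open>\<sigma>\<close>.\<close>
    define t where "t = 1 - (1 - \<sigma>) / (1 - \<rho>)"
    have t: "0 \<le> t" "t \<le> 1" "1 - t = (1 - \<sigma>) / (1 - \<rho>)"
      using that by (auto simp: t_def)
    then have "(1 - t) * (1 - \<rho>) = 1 - \<sigma>"
      using that by simp
    then have \<sigma>: "(1 - t) * \<rho> + t = \<sigma>"
      by (simp add: algebra_simps)
    have "?W \<sigma> \<le> (1 - t) * ?W \<rho> + t"
      using wasserstein_lazy_walk_mix[of \<rho> t] that t(1,2) unfolding \<sigma> by simp
    then have "(1 - t) * (1 - ?W \<rho>) \<le> 1 - ?W \<sigma>"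
      by (simp add: algebra_simps)
    then show ?thesis
      unfolding h t(3) using that by (simp add: field_simps)
  qed
  have "(h \<longlongrightarrow> Sup (h ` ({..<1} \<inter> {0<..}))) (at 1 within ({..<1} \<inter> {0<..}))"
    by (rule Lim_left_bound[of _ _ _ ?B]) (auto intro: mono bound)
  \<comment> \<open>Restricting to positive idleness is harmless, as \<open>{0<..}\<close> is an
    open set containing 1.\<close>
  also have "at 1 within ({..<1} \<inter> {0<..}) = at_left (1::real)"
    by (rule at_within_nhd[of _ "{0<..}"]) auto
  finally have lim: "(h \<longlongrightarrow> Sup (h ` ({..<1} \<inter> {0<..}))) (at_left 1)" .
  \<comment> \<open>\<open>Lim\<close> is a definite description; the convergence just shown is what
    gives it this value.\<close>
  then have "lly_curvature V E x y = Sup (h ` ({..<1} \<inter> {0<..}))"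
    unfolding lly_curvature_def h_def[symmetric] by (intro tendsto_Lim) auto
  also have "\<dots> \<le> ?B"
    by (rule cSup_least) (use bound greaterThanLessThan_empty_iff[of "0::real" 1] in
        \<open>auto simp: greaterThanLessThan_def Int_commute\<close>)
  finally show ?thesis .
qed

end

section \<open>Edge cuts as boundaries of vertex sets\<close>

text \<open>Cut edges are oriented from \<open>S\<close> outwards, so that \<open>Domain\<close> and
  \<open>Range\<close> are their ends on either side, images count cut edges at a vertex, and the
  converse exchanges the sides.\<close>

definition crossing :: "'a set \<Rightarrow> 'a rel" where
  "crossing S = {(a, b). a \<in> S \<and> b \<in> V - S \<and> b \<in> neighbors E a}"

definition edge_boundary :: "'a set \<Rightarrow> 'a set set" where
  "edge_boundary S = (\<lambda>(a, b). {a, b}) ` crossing S"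

lemma card_edge_boundary: "card (edge_boundary S) = card (crossing S)"
  unfolding edge_boundary_def
  by (rule card_image) (auto simp: inj_on_def crossing_def doubleton_eq_iff)

lemma finite_edge_boundary: "finite (crossing S) \<Longrightarrow> finite (edge_boundary S)"
  by (simp add: edge_boundary_def)

lemma crossing_compl: "S \<subseteq> V \<Longrightarrow> crossing (V - S) = (crossing S)\<inverse>"
  using neighbors_sym neighborsD(1) by (fastforce simp: crossing_def)

definition component :: "'a set set \<Rightarrow> 'a \<Rightarrow> 'a set" where
  "component F x = {y \<in> V. (x, y) \<in> (adj_rel F)\<^sup>*}"

lemma graph_components_eq: "graph_components V F = component F ` V"
  unfolding graph_components_def quotient_def component_def by auto

lemma V_nonempty: "V \<noteq> {}"
  using conn by (simp add: graph_connected_def)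

lemma graph_components_connected: "graph_components V E = {V}"
proof -
  have "component E x = V" if "x \<in> V" for x
    using conn that by (auto simp: component_def graph_connected_def)
  then show ?thesis
    using V_nonempty by (simp add: graph_components_eq image_constant_conv cong: image_cong)
qed

text \<open>Before deletion \<open>V\<close> is the only component. The components after deletion
  cover \<open>V\<close>, so they are equinumerous with \<open>{V}\<close> only if they equal
  \<open>{V}\<close>.\<close>

lemma edge_cut_iff:
  "edge_cut V E F \<longleftrightarrow> F \<subseteq> E \<and> (\<exists>x\<in>V. component (E - F) x \<noteq> V)"
proof -
  let ?C = "graph_components V (E - F)"
  have "\<Union>?C = V"
    unfolding graph_components_eq component_def by auto
  then have "{V} \<approx> ?C \<longleftrightarrow> ?C = {V}"
    using eqpoll_sym[of "{V}" ?C] by (auto simp: eqpoll_singleton_iff)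
  moreover obtain U where "U \<in> ?C"
    using V_nonempty unfolding graph_components_eq by blast
  then have "{V} \<lesssim> ?C"
    using singleton_lepoll[of V U ?C] by (simp add: insert_absorb)
  moreover have "?C = {V} \<longleftrightarrow> (\<forall>x\<in>V. component (E - F) x = V)"
    unfolding graph_components_eq using V_nonempty by blast
  ultimately show ?thesis
    unfolding edge_cut_def graph_components_connected lesspoll_def by blast
qed

text \<open>A walk that starts in \<open>S\<close> and avoids the boundary never leaves
  \<open>S\<close>.\<close>

lemma edge_cut_edge_boundary:
  assumes "S \<subseteq> V" "S \<noteq> {}" "S \<noteq> V"
  shows "edge_cut V E (edge_boundary S)"
proof -
  obtain s t where s: "s \<in> S" and t: "t \<in> V" "t \<notin> S"
    using assms by blast
  have stay: "y \<in> S" if "(s, y) \<in> (adj_rel (E - edge_boundary S))\<^sup>*" for y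
    using that
  proof induction
    case base
    then show ?case using s .
  next
    case (step y z)
    then have z: "z \<in> neighbors E y" "{y, z} \<notin> edge_boundary S"
      by (auto simp: adj_rel_def neighbors_def)
    moreover have "z \<in> V" using neighborsD(2)[OF z(1)] .
    ultimately show ?case
      using step.IH by (auto simp: edge_boundary_def crossing_def)
  qed
  then have "t \<notin> component (E - edge_boundary S) s"
    using t(2) by (auto simp: component_def)
  then have "\<exists>x\<in>V. component (E - edge_boundary S) x \<noteq> V"
    using s t(1) assms(1) by blast
  moreover have "edge_boundary S \<subseteq> E"
    by (auto simp: edge_boundary_def crossing_def neighbors_def)
  ultimately show ?thesis
    unfolding edge_cut_iff by blast
qed

text \<open>Take for \<open>S\<close> a component left by the deletion: an edge leaving it outside
  \<open>F\<close> would enlarge it.\<close>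

lemma edge_cut_contains_boundary:
  assumes "edge_cut V E F"
  obtains S where "S \<subseteq> V" "S \<noteq> {}" "S \<noteq> V" "edge_boundary S \<subseteq> F"
proof -
  obtain x where x: "x \<in> V" "component (E - F) x \<noteq> V"
    using assms unfolding edge_cut_iff by blast
  have "{a, b} \<in> F" if ab: "(a, b) \<in> crossing (component (E - F) x)" for a b
  proof (rule ccontr)
    assume "{a, b} \<notin> F"
    then have "(a, b) \<in> adj_rel (E - F)"
      using ab by (simp add: adj_rel_def crossing_def neighbors_def)
    then show False
      using ab by (auto simp: crossing_def component_def intro: rtrancl_into_rtrancl)
  qed
  then have "edge_boundary (component (E - F) x) \<subseteq> F"
    by (auto simp: edge_boundary_def)
  moreover have "x \<in> component (E - F) x" "component (E - F) x \<subseteq> V"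
    using x(1) by (auto simp: component_def)
  ultimately show ?thesis
    using that x(2) by blast
qed

section \<open>Edge-connectivity as a minimum over vertex sets\<close>

lemma edge_connectivity_le:
  assumes "card V \<noteq> 1" "S \<subseteq> V" "S \<noteq> {}" "S \<noteq> V" "finite (crossing S)"
  shows "edge_connectivity V E \<le> card (crossing S)"
proof -
  have "edge_cut V E (edge_boundary S) \<and> finite (edge_boundary S)
      \<and> card (edge_boundary S) = card (crossing S)"
    using assms edge_cut_edge_boundary finite_edge_boundary card_edge_boundary by blast
  then have "(LEAST k. \<exists>F. edge_cut V E F \<and> finite F \<and> card F = k) \<le> card (crossing S)"
    by (intro Least_le) (rule exI)
  then show ?thesis
    using assms(1) by (simp add: edge_connectivity_def)
qed

lemma edge_connectivity_attained:
  assumes "card V \<noteq> 1"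
  obtains S where "S \<subseteq> V" "S \<noteq> {}" "S \<noteq> V" "finite (crossing S)"
    "card (crossing S) = edge_connectivity V E"
proof -
  obtain x where x: "x \<in> V"
    using V_nonempty by blast
  \<comment> \<open>The edges at one vertex form a finite cut, so the \<open>LEAST\<close> ranges
    over a non-empty set.\<close>
  have "crossing {x} \<subseteq> {x} \<times> neighbors E x"
    by (auto simp: crossing_def)
  then have fin: "finite (crossing {x})"
    by (rule finite_subset) (simp add: finite_neighbors x)
  have "V \<noteq> {x}"
    using assms by (metis is_singletonI is_singleton_altdef)
  with x have "edge_cut V E (edge_boundary {x})"
    by (intro edge_cut_edge_boundary) auto
  then have "\<exists>k F. edge_cut V E F \<and> finite F \<and> card F = k"
    using finite_edge_boundary[OF fin] by blast
  then have "\<exists>F. edge_cut V E F \<and> finite F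
      \<and> card F = (LEAST k. \<exists>F. edge_cut V E F \<and> finite F \<and> card F = k)"
    by (rule LeastI_ex)
  moreover have "edge_connectivity V E = (LEAST k. \<exists>F. edge_cut V E F \<and> finite F \<and> card F = k)"
    using assms by (simp add: edge_connectivity_def)
  ultimately obtain F where F: "edge_cut V E F" "finite F" "card F = edge_connectivity V E"
    by metis
  obtain S where S: "S \<subseteq> V" "S \<noteq> {}" "S \<noteq> V" "edge_boundary S \<subseteq> F"
    using edge_cut_contains_boundary[OF F(1)] by blast
  have "inj_on (\<lambda>(a, b). {a, b}) (crossing S)"
    by (auto simp: inj_on_def crossing_def doubleton_eq_iff)
  then have fS: "finite (crossing S)"
    using finite_subset[OF S(4) F(2)] by (simp add: edge_boundary_def finite_image_iff)
  \<comment> \<open>The boundary inside the minimum cut \<open>F\<close> is itself a cut, so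
    equality must hold.\<close>
  have "card (crossing S) \<le> edge_connectivity V E"
    using card_mono[OF F(2) S(4)] F(3) by (simp add: card_edge_boundary)
  then have "card (crossing S) = edge_connectivity V E"
    using edge_connectivity_le[OF assms S(1-3) fS] by simp
  then show ?thesis
    by (rule that[OF S(1-3) fS])
qed

section \<open>Counting along a minimum cut\<close>

text \<open>For an end \<open>a\<close> of a cut edge in \<open>S\<close>, this counts the
  neighbours where the test function of \<open>excess_sum_le_0\<close> is -1.\<close>

definition inner_degree :: "'a set \<Rightarrow> 'a \<Rightarrow> nat" where
  "inner_degree S a = card (neighbors E a \<inter> S - Domain (crossing S))"

definition outer_degree :: "'a set \<Rightarrow> 'a \<Rightarrow> nat" where
  "outer_degree S a = card (crossing S `` {a})"

lemma crossing_Image: "a \<in> S \<Longrightarrow> crossing S `` {a} = neighbors E a - S"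
  using neighborsD(2) by (auto simp: crossing_def)

text \<open>A neighbour of \<open>a\<close> is across the cut, deep in \<open>S\<close>, or another
  end of a cut edge in \<open>S\<close>; the \<open>+ 1\<close> arises because \<open>a\<close> is
  not its own neighbour.\<close>

lemma degree_le_inner_outer:
  assumes "S \<subseteq> V" "finite (crossing S)" "a \<in> Domain (crossing S)"
  shows "degree E a + 1 \<le> inner_degree S a + outer_degree S a + card (Domain (crossing S))"
proof -
  let ?A = "Domain (crossing S)"
  have a: "a \<in> S" "a \<in> V" "finite ?A"
    using assms(1,3) finite_Domain[OF assms(2)] by (auto simp: crossing_def)
  have "neighbors E a \<subseteq> (neighbors E a \<inter> S - ?A) \<union> crossing S `` {a} \<union> (?A - {a})"
    unfolding crossing_Image[OF a(1)] using neighborsD(3) by blast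
  moreover have fin: "finite ((neighbors E a \<inter> S - ?A) \<union> crossing S `` {a} \<union> (?A - {a}))"
    unfolding crossing_Image[OF a(1)] using finite_neighbors a by auto
  ultimately have "degree E a \<le> card ((neighbors E a \<inter> S - ?A) \<union> crossing S `` {a} \<union> (?A - {a}))"
    unfolding degree_def by (metis card_mono)
  also have "\<dots> \<le> inner_degree S a + outer_degree S a + card (?A - {a})"
    unfolding inner_degree_def outer_degree_def
    by (meson card_Un_le le_trans add_le_mono1)
  finally show ?thesis
    using card_Suc_Diff1[OF a(3) assms(3)] by linarith
qed

text \<open>For the \<open>f\<close> of \<open>excess_sum_le_0\<close> and a cut edge from
  \<open>a\<close> to \<open>b\<close>, the Laplacians at \<open>a\<close> and \<open>b\<close> are
  \<open>- excess S a\<close> and \<open>excess (V - S) b\<close>. The sign makes the two sides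
  symmetric.\<close>

definition excess :: "'a set \<Rightarrow> 'a \<Rightarrow> real" where
  "excess S a = (real (inner_degree S a) - real (outer_degree S a)) / real (degree E a)"

lemma excess_sum_le_0:
  assumes nonneg: "nonneg_lly_curvature V E"
    and S: "S \<subseteq> V" and ab: "(a, b) \<in> crossing S"
  shows "excess S a + excess (V - S) b \<le> 0"
proof -
  let ?A = "Domain (crossing S)" and ?B = "Range (crossing S)"
  define f :: "'a \<Rightarrow> real" where
    "f v = (if v \<in> S then if v \<in> ?A then 0 else -1 else if v \<in> ?B then 1 else 2)" for v
  have a: "a \<in> S" "a \<in> ?A" "a \<in> V" and b: "b \<in> V - S" "b \<in> ?B" "b \<in> neighbors E a"
    using ab S by (auto simp: crossing_def)
  \<comment> \<open>Only an edge leaving \<open>S\<close> could rise by more than 1, but its ends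
    lie in \<open>?A\<close> and \<open>?B\<close>, where \<open>f\<close> is 0 and 1.\<close>
  have lip: "f v - f u \<le> 1" if "v \<in> neighbors E u" for u v
  proof (cases "u \<in> S \<and> v \<notin> S")
    case True
    then have "(u, v) \<in> crossing S"
      using that neighborsD(2) by (simp add: crossing_def)
    then show ?thesis
      using True by (auto simp: f_def)
  qed (auto simp: f_def)
  have "lly_curvature V E a b \<ge> 0"
    using nonneg a b neighborsD(3)[OF b(3)] unfolding nonneg_lly_curvature_def by blast
  also have "lly_curvature V E a b \<le> laplacian E f a - laplacian E f b"
    by (rule lly_curvature_le[OF b(3) lip]) (use a b in \<open>auto simp: f_def\<close>)
  finally have le: "laplacian E f b \<le> laplacian E f a" by simp
  have "(\<Sum>z\<in>neighbors E a. f z - f a)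
      = (\<Sum>z\<in>neighbors E a. of_bool (z \<in> neighbors E a - S) - of_bool (z \<in> neighbors E a \<inter> S - ?A))"
  proof (rule sum.cong)
    fix z assume z: "z \<in> neighbors E a"
    then have "z \<in> ?B" if "z \<notin> S"
      using that a neighborsD(2)[OF z] by (auto simp: crossing_def)
    then show "f z - f a = of_bool (z \<in> neighbors E a - S) - of_bool (z \<in> neighbors E a \<inter> S - ?A)"
      using z a by (auto simp: f_def)
  qed simp
  also have "\<dots> = real (outer_degree S a) - real (inner_degree S a)"
    unfolding outer_degree_def inner_degree_def crossing_Image[OF a(1)] sum_subtractf
    by (intro arg_cong2[where f = minus] sum_of_bool_mem finite_neighbors[OF a(3)]) auto
  finally have la: "laplacian E f a = - excess S a"
    by (simp add: laplacian_def excess_def minus_divide_left)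
  have "(\<Sum>z\<in>neighbors E b. f z - f b)
      = (\<Sum>z\<in>neighbors E b. of_bool (z \<in> neighbors E b \<inter> (V - S) - ?B) - of_bool (z \<in> neighbors E b - (V - S)))"
  proof (rule sum.cong)
    fix z assume z: "z \<in> neighbors E b"
    then have "z \<in> ?A" if "z \<in> S"
      using that b neighbors_sym by (auto simp: crossing_def)
    then show "f z - f b = of_bool (z \<in> neighbors E b \<inter> (V - S) - ?B) - of_bool (z \<in> neighbors E b - (V - S))"
      using z b neighborsD(2)[OF z] by (auto simp: f_def)
  qed simp
  also have "\<dots> = real (inner_degree (V - S) b) - real (outer_degree (V - S) b)"
    unfolding outer_degree_def inner_degree_def crossing_Image[OF b(1)] sum_subtractf
    unfolding crossing_compl[OF S] Domain_converse using b(1)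
    by (intro arg_cong2[where f = minus] sum_of_bool_mem finite_neighbors) auto
  finally have "laplacian E f b = excess (V - S) b"
    by (simp add: laplacian_def excess_def)
  with la le show ?thesis by simp
qed

text \<open>By \<open>degree_le_inner_outer\<close>, each excess is at least
  \<open>1 - s / D\<close>, where \<open>s\<close> is twice the outer degree plus the number of cut
  ends on that side minus 1. The sum of the two excesses is at most 0.\<close>

lemma crossing_pair_bound:
  assumes nonneg: "nonneg_lly_curvature V E"
    and S: "S \<subseteq> V" and fin: "finite (crossing S)" and ab: "(a, b) \<in> crossing S"
    and D: "D > 0" "\<And>v. v \<in> V \<Longrightarrow> D \<le> degree E v"
  shows "2 * D + 2 \<le> 2 * outer_degree S a + 2 * outer_degree (V - S) b
           + card (Domain (crossing S)) + card (Range (crossing S))"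
proof -
  have lower: "1 - (2 * real (outer_degree T v) + real (card (Domain (crossing T))) - 1) / real D
      \<le> excess T v"
    if T: "T \<subseteq> V" "finite (crossing T)" "v \<in> Domain (crossing T)" for T v
  proof -
    let ?s = "2 * real (outer_degree T v) + real (card (Domain (crossing T))) - 1"
    have "card (Domain (crossing T)) > 0"
      using T finite_Domain by (auto simp: card_gt_0_iff)
    then have s: "?s \<ge> 0" by simp
    have "v \<in> V"
      using T by (auto simp: crossing_def)
    then have d: "D \<le> degree E v" by (rule D(2))
    have "real (degree E v) - ?s \<le> real (inner_degree T v) - real (outer_degree T v)"
      using degree_le_inner_outer[OF T] by linarith
    then have "(real (degree E v) - ?s) / real (degree E v) \<le> excess T v"
      unfolding excess_def by (rule divide_right_mono) simp
    then have "1 - ?s / real (degree E v) \<le> excess T v"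
      using d D(1) by (simp add: diff_divide_distrib)
    \<comment> \<open>Replacing the degree by the smaller \<open>D\<close> goes in this direction
      because \<open>?s\<close> is non-negative.\<close>
    moreover have "?s / real (degree E v) \<le> ?s / real D"
      using s d D(1) by (intro divide_left_mono) auto
    ultimately show ?thesis by linarith
  qed
  let ?s = "2 * real (outer_degree S a) + real (card (Domain (crossing S))) - 1"
  let ?t = "2 * real (outer_degree (V - S) b) + real (card (Range (crossing S))) - 1"
  have "1 - ?s / real D \<le> excess S a"
    using lower[OF S fin] ab by blast
  moreover have "1 - ?t / real D \<le> excess (V - S) b"
    using lower[of "V - S" b] ab fin by (auto simp: crossing_compl[OF S])
  ultimately have "2 \<le> ?s / real D + ?t / real D"
    using excess_sum_le_0[OF nonneg S ab] by linarith
  then have "2 \<le> (?s + ?t) / real D"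
    by (simp only: add_divide_distrib)
  then have "2 * real D \<le> ?s + ?t"
    using D(1) by (simp add: pos_le_divide_eq)
  then show ?thesis by linarith
qed

text \<open>Every outer end \<open>b\<close> meets one cut edge, so its large degree makes its
  excess positive. Hence \<open>a\<close> has negative excess, that is, fewer neighbours in
  \<open>S\<close> than across, and \<open>S - {a}\<close> has a smaller boundary.\<close>

lemma crossing_not_star:
  assumes nonneg: "nonneg_lly_curvature V E"
    and S: "S \<subseteq> V" "S \<noteq> V" and fin: "finite (crossing S)"
    and star: "Domain (crossing S) = {a}"
    and minimal: "\<And>T. T \<subseteq> V \<Longrightarrow> T \<noteq> {} \<Longrightarrow> T \<noteq> V \<Longrightarrow> finite (crossing T) \<Longrightarrow>
      card (crossing S) \<le> card (crossing T)"
    and D: "\<And>v. v \<in> V \<Longrightarrow> card (crossing S) + 2 \<le> degree E v"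
  shows False
proof -
  obtain b where ab: "(a, b) \<in> crossing S"
    using star by blast
  have a: "a \<in> S" "a \<in> V" and b: "b \<in> V"
    using ab S by (auto simp: crossing_def)
  have dom: "u = a" if "(u, v) \<in> crossing S" for u v
    using star that by blast
  then have "crossing S = {a} \<times> crossing S `` {a}"
    by auto
  then have "card (crossing S) = card ({a} \<times> crossing S `` {a})"
    by (rule arg_cong)
  then have outer_a: "outer_degree S a = card (crossing S)"
    by (simp add: outer_degree_def card_cartesian_product)
  have "(crossing S)\<inverse> `` {b} = {a}"
    using ab star by (fast dest: dom)
  then have outer_b: "outer_degree (V - S) b = 1"
    by (simp add: outer_degree_def crossing_compl[OF S(1)])
  have "card (Range (crossing S)) \<le> card (crossing S)"
    using fin by (simp add: Range_snd card_image_le)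
  moreover have "degree E b + 1 \<le> inner_degree (V - S) b + outer_degree (V - S) b
      + card (Range (crossing S))"
    using degree_le_inner_outer[of "V - S" b] ab fin by (auto simp: crossing_compl[OF S(1)])
  ultimately have "inner_degree (V - S) b > outer_degree (V - S) b"
    using D[OF b] outer_b by linarith
  then have "excess (V - S) b > 0"
    using D[OF b] by (simp add: excess_def)
  then have "excess S a < 0"
    using excess_sum_le_0[OF nonneg S(1) ab] by linarith
  then have inner_a: "inner_degree S a < card (crossing S)"
    using outer_a D[OF a(2)] by (simp add: excess_def divide_less_0_iff)
  have inner: "inner_degree S a = card (neighbors E a \<inter> S)"
  proof -
    have "a \<notin> neighbors E a"
      using neighborsD(3) by blast
    then have "neighbors E a \<inter> S - {a} = neighbors E a \<inter> S"
      by blast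
    then show ?thesis
      by (simp add: inner_degree_def star)
  qed
  \<comment> \<open>Otherwise all edges at \<open>a\<close> are cut edges, too few for its
    degree.\<close>
  have "S - {a} \<noteq> {}"
  proof
    assume "S - {a} = {}"
    then have "neighbors E a \<inter> S = {}"
      using neighborsD(3)[of a a] by blast
    then have "degree E a + 1 \<le> card (crossing S) + 1"
      using degree_le_inner_outer[OF S(1) fin, of a] star outer_a inner by simp
    with D[OF a(2)] show False by simp
  qed
  \<comment> \<open>An edge leaving \<open>S - {a}\<close> must end in \<open>a\<close>: one that
    left \<open>S\<close> too would start at \<open>a\<close>.\<close>
  have sub: "crossing (S - {a}) \<subseteq> (\<lambda>z. (z, a)) ` (neighbors E a \<inter> S)"
  proof (clarify)
    fix u v assume uv: "(u, v) \<in> crossing (S - {a})"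
    have "v \<in> S"
    proof (rule ccontr)
      assume "v \<notin> S"
      with uv have "(u, v) \<in> crossing S"
        by (simp add: crossing_def)
      then have "u = a"
        by (rule dom)
      with uv show False
        by (simp add: crossing_def)
    qed
    with uv have "v = a" "u \<in> neighbors E a \<inter> S"
      using neighbors_sym[of a u] by (auto simp: crossing_def)
    then show "(u, v) \<in> (\<lambda>z. (z, a)) ` (neighbors E a \<inter> S)"
      by simp
  qed
  have finN: "finite (neighbors E a \<inter> S)"
    using finite_neighbors[OF a(2)] by blast
  then have "card (crossing S) \<le> card (crossing (S - {a}))"
    using S \<open>S - {a} \<noteq> {}\<close> finite_subset[OF sub] by (intro minimal) auto
  also have "\<dots> \<le> card (neighbors E a \<inter> S)"
    by (rule le_trans[OF card_mono[OF finite_imageI[OF finN] sub] card_image_le[OF finN]])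
  finally show False
    using inner inner_a by simp
qed

lemma degree_le_minimum_cut:
  assumes nonneg: "nonneg_lly_curvature V E"
    and S: "S \<subseteq> V" "S \<noteq> {}" "S \<noteq> V" and fin: "finite (crossing S)"
    and minimal: "\<And>T. T \<subseteq> V \<Longrightarrow> T \<noteq> {} \<Longrightarrow> T \<noteq> V \<Longrightarrow> finite (crossing T) \<Longrightarrow>
      card (crossing S) \<le> card (crossing T)"
  shows "\<exists>v\<in>V. degree E v \<le> card (crossing S) + 1"
proof (rule ccontr)
  assume "\<not> ?thesis"
  then have D: "card (crossing S) + 2 \<le> degree E v" if "v \<in> V" for v
    using that by force
  have conv: "crossing (V - S) = (crossing S)\<inverse>"
    by (rule crossing_compl[OF S(1)])
  \<comment> \<open>An empty cut contradicts connectivity. This excludes 0 in the bounds by 1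
    below.\<close>
  have ne: "crossing S \<noteq> {}"
  proof
    assume empty: "crossing S = {}"
    obtain s t where st: "s \<in> S" "t \<in> V - S"
      using S by blast
    have "(s, t) \<in> (adj_rel E)\<^sup>*"
      using conn st S(1) unfolding graph_connected_def by blast
    then have "t \<in> S"
    proof induction
      case base
      then show ?case using st by simp
    next
      case (step y z)
      then show ?case
        using empty neighborsD(2)[of z y] by (auto simp: crossing_def adj_rel_def neighbors_def)
    qed
    with st show False by simp
  qed
  have "card (Domain (crossing S)) \<le> 1 \<or> card (Range (crossing S)) \<le> 1"
  proof (rule star_if_heavy[OF fin])
    fix a b assume ab: "(a, b) \<in> crossing S"
    \<comment> \<open>\<open>crossing_pair_bound\<close> with
      \<open>D = card (crossing S) + 2\<close>.\<close>
    show "2 * card (crossing S) + 6 \<le> 2 * card (crossing S `` {a}) + 2 * card ((crossing S)\<inverse> `` {b})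
        + card (Domain (crossing S)) + card (Range (crossing S))"
      using crossing_pair_bound[OF nonneg S(1) fin ab _ D] by (simp add: outer_degree_def conv)
  qed
  then show False
  proof
    assume "card (Domain (crossing S)) \<le> 1"
    moreover have "card (Domain (crossing S)) > 0"
      using ne fin finite_Domain by (fastforce simp: card_gt_0_iff)
    ultimately obtain a where "Domain (crossing S) = {a}"
      by (metis One_nat_def Suc_leI card_1_singletonE le_antisym)
    then show False
      by (rule crossing_not_star[OF nonneg S(1,3) fin _ minimal D])
  next
    assume "card (Range (crossing S)) \<le> 1"
    moreover have "card (Range (crossing S)) > 0"
      using ne fin finite_Range by (fastforce simp: card_gt_0_iff)
    ultimately obtain b where "Range (crossing S) = {b}"
      by (metis One_nat_def Suc_leI card_1_singletonE le_antisym)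
    \<comment> \<open>The same argument for \<open>V - S\<close>, whose crossing relation is the
      converse.\<close>
    then show False
      using S fin minimal D
      by (intro crossing_not_star[OF nonneg, of "V - S" b]) (auto simp: conv card_inverse)
  qed
qed

end

theorem theorem1p3:
  fixes V :: "'a set" and E :: "'a set set"
  assumes "simple_graph V E"
    and "locally_finite V E"
    and "graph_connected V E"
    and "nonneg_lly_curvature V E"
  shows "int (edge_connectivity V E) \<ge> int (min_degree V E) - 1"
proof (cases "card V = 1")
  case True
  then obtain x where x: "V = {x}"
    by (rule card_1_singletonE)
  have "neighbors E x = {}"
    using assms(1) unfolding simple_graph_def neighbors_def x by (force simp: subset_singleton_iff)
  then show ?thesis
    by (simp add: min_degree_def x degree_def)
next
  case False
  \<comment> \<open>Infinite graphs belong to this case, since \<open>card\<close> is 0 on infinite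
    sets.\<close>
  interpret connected_lf_graph V E
    by unfold_locales fact+
  obtain S where S: "S \<subseteq> V" "S \<noteq> {}" "S \<noteq> V" "finite (crossing S)"
    "card (crossing S) = edge_connectivity V E"
    using edge_connectivity_attained[OF False] by blast
  obtain v where "v \<in> V" "degree E v \<le> edge_connectivity V E + 1"
    using degree_le_minimum_cut[OF assms(4) S(1-4)] edge_connectivity_le[OF False] S(5) by metis
  moreover from \<open>v \<in> V\<close> have "min_degree V E \<le> degree E v"
    unfolding min_degree_def by (intro cINF_lower) auto
  ultimately show ?thesis by linarith
qed

end
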